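(* A locally finite connected graph $G$ is claw-free and net-free if and only if for every minimal finite separator $S \subseteq V(G)$ and every $v \in S$, the graph $G - (S \setminus \{v\})$ is distance-$2$-complete centered at $v$.
   Context: Graphs are undirected and simple, finite or infinite. A graph is locally finite if every vertex has finite degree. A graph is $H$-free if it has no induced subgraph isomorphic to $H$. The claw is $K_{1,3}$. The net is the graph on six vertices obtained from a triangle by attaching one new pendant (degree $1$) vertex to each of the three vertices of the triangle. A (vertex) separator of $G$ is a set $S\subseteq V(G)$ such that $G-S$ is disconnected (has at least two components); it is minimal if it is $\subseteq$-minimal among vertex separators, i.e. no proper subset of $S$ is a separator of $G$. A graph $H$ with a vertex $v\in V(H)$ is called distance-$2$-complete centered at $v$ if $H-v$ has exactly two components and, for each component $C$ of $H-v$ and each $i\in\mathbb{N}$, the vertices at distance $i$ from $v$ in $H[V(C)\cup\{v\}]$ induce a complete graph. *)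

theory Defs
  imports "Graph_Theory.Graph_Theory"
begin

text \<open>
  Following the convention of \<^locale>\<open>graph\<close>, an undirected graph is a digraph whose arc set is
  symmetric. A simple graph, finite or infinite, is a \<^locale>\<open>pair_bidirected_digraph\<close>: a vertex
  set with a symmetric and irreflexive relation on it. For such graphs the strongly connected
  components (\<^const>\<open>pre_digraph.sccs_verts\<close>, given as vertex sets) are the components.
\<close>

definition delete_verts :: "('a, 'b) pre_digraph \<Rightarrow> 'a set \<Rightarrow> ('a, 'b) pre_digraph" where
  "delete_verts G S = G \<restriction> (verts G - S)"

(* out_degree would be 0 at a vertex of infinite degree, so the finiteness is stated on out_arcs *)
definition locally_finite :: "('a, 'b) pre_digraph \<Rightarrow> bool" where
  "locally_finite G \<longleftrightarrow> (\<forall>v \<in> verts G. finite (out_arcs G v))"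

definition complete_graph :: "('a, 'b) pre_digraph \<Rightarrow> bool" where
  "complete_graph G \<longleftrightarrow> (\<forall>u \<in> verts G. \<forall>w \<in> verts G. u \<noteq> w \<longrightarrow> u \<rightarrow>\<^bsub>G\<^esub> w)"

definition induced_free :: "('c, 'd) pre_digraph \<Rightarrow> ('a, 'b) pre_digraph \<Rightarrow> bool" where
  "induced_free H G \<longleftrightarrow> \<not> (\<exists>K. induced_subgraph K G \<and> digraph_iso K H)"

definition claw :: "nat pair_pre_digraph" where
  "claw = (let E = {(0, 1), (0, 2), (0, 3)} in
     \<lparr> pverts = {0, 1, 2, 3}, parcs = E \<union> E\<inverse> \<rparr>)"

lemma claw_K13: "K\<^bsub>1,3\<^esub> (with_proj claw)"
  unfolding complete_bipartite_digraph_pair_def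
  apply (simp add: claw_def)
  apply (rule exI[of _ "{0}"], rule exI[of _ "{1,2,3}"])
  apply auto
  done

definition net :: "nat pair_pre_digraph" where
  "net = (let E = {(0, 1), (1, 2), (0, 2), (0, 3), (1, 4), (2, 5)} in
     \<lparr> pverts = {0, 1, 2, 3, 4, 5}, parcs = E \<union> E\<inverse> \<rparr>)"

definition separator :: "('a, 'b) pre_digraph \<Rightarrow> 'a set \<Rightarrow> bool" where
  "separator G S \<longleftrightarrow> S \<subseteq> verts G \<and>
     (\<exists>C D. C \<in> pre_digraph.sccs_verts (delete_verts G S) \<and>
            D \<in> pre_digraph.sccs_verts (delete_verts G S) \<and> C \<noteq> D)"

definition minimal_separator :: "('a, 'b) pre_digraph \<Rightarrow> 'a set \<Rightarrow> bool" where
  "minimal_separator G S \<longleftrightarrow> separator G S \<and> (\<forall>T. T \<subset> S \<longrightarrow> \<not> separator G T)"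

(* With unit weights, the infimum mu of the walk costs is the graph distance; it is infinite
   for unreachable vertices, which therefore lie in no distance class. *)
definition verts_at_dist :: "('a, 'b) pre_digraph \<Rightarrow> 'a \<Rightarrow> nat \<Rightarrow> 'a set" where
  "verts_at_dist G v i = {u \<in> verts G. wf_digraph.\<mu> G (\<lambda>_. 1) v u = ereal (real i)}"

lemma verts_at_dist_iff:
  assumes "wf_digraph G"
  shows "verts_at_dist G v i = {u \<in> verts G. (\<exists>p. pre_digraph.awalk G v p u \<and> length p = i) \<and>
     (\<forall>p. pre_digraph.awalk G v p u \<longrightarrow> i \<le> length p)}"
proof -
  interpret wf_digraph G by fact
  have "\<mu> (\<lambda>_. 1) v u = ereal (real i) \<longleftrightarrow> (\<exists>p. awalk v p u \<and> length p = i) \<and>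
     (\<forall>p. awalk v p u \<longrightarrow> i \<le> length p)" for u
  proof (cases "\<exists>p. awalk v p u")
    case False
    then have "{p. awalk v p u} = {}" by auto
    then show ?thesis using False unfolding \<mu>_def by (simp add: top_ereal_def)
  next
    case True
    define q where "q = arg_min length (\<lambda>p. awalk v p u)"
    have q: "awalk v q u" "\<And>p. awalk v p u \<Longrightarrow> length q \<le> length p"
      using True arg_min_nat_lemma[of "\<lambda>p. awalk v p u" _ length] by (auto simp: q_def)
    have "\<mu> (\<lambda>_. 1) v u = ereal (real (length q))"
      unfolding \<mu>_def awalk_cost_def sum_list_triv map_replicate_const
      by (rule antisym) (auto intro!: INF_lower2[of q] INF_greatest simp: q sum_list_replicate)
    then show ?thesis using q by (auto intro: le_antisym)
  qed
  then show ?thesis unfolding verts_at_dist_def by auto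
qed

definition distance_2_complete :: "('a, 'b) pre_digraph \<Rightarrow> 'a \<Rightarrow> bool" where
  "distance_2_complete H v \<longleftrightarrow> v \<in> verts H \<and>
     card (pre_digraph.sccs_verts (delete_verts H {v})) = 2 \<and>
     (\<forall>C \<in> pre_digraph.sccs_verts (delete_verts H {v}). \<forall>i.
        complete_graph (H \<restriction> verts_at_dist (H \<restriction> (C \<union> {v})) v i))"

end

theory Submission
  imports Defs
begin

text \<open>
  Call a component of \<open>G - S\<close> full if every vertex of \<open>S\<close> has a neighbour in it. If \<open>S\<close> is a minimal
  separator, then every component of \<open>G - S\<close> is full, because putting back a single vertex of \<open>S\<close>
  reconnects the graph.

  Let \<open>G\<close> be claw-free and net-free, and let \<open>v \<in> S\<close>. Three components would give a claw at \<open>v\<close>, so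
  there are two. Inside \<open>C \<union> {v}\<close>, for a component \<open>C\<close>, a non-adjacent pair at a first
  distance \<open>i + 1\<close> produces a claw or a net, built from the pair, its neighbours at distance \<open>i\<close> and
  vertices nearer to \<open>v\<close>; where these run out, a neighbour of \<open>v\<close> in the other component serves
  (\<open>levels_complete\<close>).

  For the converse one needs minimal separators through prescribed vertices, and the difficulty is that
  minimality is among all separators, not only among those that separate two given vertices. The
  hypothesis itself removes this difficulty: every finite \<open>S\<close> with two full components is then a
  minimal separator (\<open>two_full_components_minimal\<close>). So for a finite connected set \<open>K\<close>, a vertex \<open>d\<close>
  neither in \<open>K\<close> nor adjacent to it, and a common neighbour \<open>x\<close> of both, one finds a finite minimal
  separator through \<open>x\<close>, inside the neighbourhood of \<open>K\<close>, that separates \<open>K\<close> from \<open>d\<close>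
  (\<open>exists_separating_minimal_separator\<close>). Taking \<open>K\<close> to be a leaf of a claw, or two adjacent triangle
  vertices of a net with their pendants, and \<open>d\<close> another leaf or the third pendant, the distance
  classes 1 or 2 around \<open>x\<close> contain a non-adjacent pair.
\<close>

section \<open>Forbidden induced subgraphs as vertex patterns\<close>

text \<open>
  An isomorphism record carries an arc map and new end maps; between graphs whose arcs are pairs all
  of this is determined by the vertex map, so the existence of an induced copy of \<open>H\<close> only concerns
  an injection of vertices that preserves adjacency and non-adjacency. The vertex map of an isomorphism
  runs from the copy to \<open>H\<close>, hence the inverses.
\<close>
lemma not_induced_free_iff_embedding:
  fixes H :: "'c pair_pre_digraph" and G :: "'a pair_pre_digraph"
  assumes "pair_wf_digraph G" "pair_wf_digraph H"
  shows "\<not> induced_free H G \<longleftrightarrow>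
    (\<exists>f. inj_on f (pverts H) \<and> f ` pverts H \<subseteq> pverts G \<and>
      (\<forall>u \<in> pverts H. \<forall>w \<in> pverts H. (u, w) \<in> parcs H \<longleftrightarrow> (f u, f w) \<in> parcs G))"
    (is "_ \<longleftrightarrow> (\<exists>f. ?emb f)")
proof
  assume "\<not> induced_free H G"
  then obtain K h where K: "induced_subgraph K G"
    and h: "pre_digraph.digraph_isomorphism K h" and H: "with_proj H = app_iso h K"
    unfolding induced_free_def digraph_iso_def by blast
  have sub: "verts K \<subseteq> pverts G" "tail K = fst" "head K = snd"
    and arcsK: "arcs K = {e \<in> parcs G. fst e \<in> verts K \<and> snd e \<in> verts K}"
    using K compatible_tail[of G K] compatible_head[of G K]
    by (auto simp: induced_subgraph_def subgraph_def)
  have V: "pverts H = iso_verts h ` verts K" and A: "parcs H = iso_arcs h ` arcs K"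
    and ends: "iso_tail h = fst" "iso_head h = snd"
    using arg_cong[OF H, of verts] arg_cong[OF H, of arcs] arg_cong[OF H, of tail]
      arg_cong[OF H, of head] by simp_all
  have arc: "iso_arcs h e = (iso_verts h (fst e), iso_verts h (snd e))" if "e \<in> arcs K" for e
    using h that by (auto simp: pre_digraph.digraph_isomorphism_def sub ends prod_eq_iff)
  have inj: "inj_on (iso_verts h) (verts K)"
    using h by (auto simp: pre_digraph.digraph_isomorphism_def)
  have A': "parcs H = (\<lambda>e. (iso_verts h (fst e), iso_verts h (snd e))) ` arcs K"
    unfolding A by (rule image_cong) (simp_all add: arc)
  let ?f = "the_inv_into (verts K) (iso_verts h)"
  have "(iso_verts h u, iso_verts h w) \<in> parcs H \<longleftrightarrow> (u, w) \<in> parcs G"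
    if "u \<in> verts K" "w \<in> verts K" for u w
    using that unfolding A' arcsK
    by (auto simp: inj_on_eq_iff[OF inj] intro: rev_image_eqI)
  then have "?emb ?f"
    using inj sub(1) unfolding V
    by (auto simp: the_inv_into_f_f intro: inj_on_the_inv_into)
  then show "\<exists>f. ?emb f" by (intro exI[where x = ?f])
next
  assume "\<exists>f. ?emb f"
  then obtain f where f: "inj_on f (pverts H)" "f ` pverts H \<subseteq> pverts G"
    and arcf: "\<And>u w. u \<in> pverts H \<Longrightarrow> w \<in> pverts H \<Longrightarrow> (u, w) \<in> parcs H \<longleftrightarrow> (f u, f w) \<in> parcs G"
    by blast
  interpret H: pair_wf_digraph H by fact
  interpret G: pair_wf_digraph G by fact
  define g where "g = the_inv_into (pverts H) f"
  define K where "K = with_proj G \<restriction> (f ` pverts H)"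
  define h where "h = \<lparr>iso_verts = g, iso_arcs = map_prod g g, iso_head = snd, iso_tail = fst\<rparr>"
  have gf: "g (f u) = u" if "u \<in> pverts H" for u
    using f(1) that by (simp add: g_def the_inv_into_f_f)
  have arcsK: "arcs K = map_prod f f ` parcs H"
  proof (intro set_eqI iffI)
    fix e assume "e \<in> arcs K"
    then obtain u w where "e = (f u, f w)" "u \<in> pverts H" "w \<in> pverts H" "(f u, f w) \<in> parcs G"
      by (cases e) (auto simp: K_def)
    then show "e \<in> map_prod f f ` parcs H" using arcf by (auto intro: rev_image_eqI)
  next
    fix e assume "e \<in> map_prod f f ` parcs H"
    then obtain u w where e: "e = (f u, f w)" "(u, w) \<in> parcs H" by auto
    then show "e \<in> arcs K" using arcf[of u w] H.in_arcsD1 H.in_arcsD2 by (simp add: K_def)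
  qed
  have "induced_subgraph K G"
    unfolding K_def by (rule G.induced_induce) (use f in auto)
  moreover have "pre_digraph.digraph_isomorphism K h"
    unfolding pre_digraph.digraph_isomorphism_def
  proof (intro conjI ballI)
    show "wf_digraph K" by (auto simp: K_def wf_digraph_def)
    show "inj_on (iso_verts h) (verts K)" by (auto simp: K_def h_def inj_on_def gf)
    show "inj_on (iso_arcs h) (arcs K)"
      using H.wellformed' by (auto simp: arcsK h_def inj_on_def gf)
  qed (auto simp: K_def h_def)
  moreover have "with_proj H = app_iso h K"
  proof (rule pre_digraph.equality)
    show "verts (with_proj H) = verts (app_iso h K)"
      by (simp add: h_def K_def image_image gf)
    have "(\<lambda>e. map_prod g g (map_prod f f e)) ` parcs H = (\<lambda>e. e) ` parcs H"
      using H.wellformed' by (intro image_cong) (auto simp: gf)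
    then show "arcs (with_proj H) = arcs (app_iso h K)" by (simp add: h_def arcsK image_image)
  qed (simp_all add: h_def)
  ultimately show "\<not> induced_free H G"
    unfolding induced_free_def digraph_iso_def by blast
qed

lemma pair_wf_claw: "pair_wf_digraph claw"
  by unfold_locales (auto simp: claw_def)

lemma pair_wf_net: "pair_wf_digraph net"
  by unfold_locales (auto simp: net_def)

context pair_bidirected_digraph
begin

abbreviation adj :: "'a \<Rightarrow> 'a \<Rightarrow> bool" (infix \<open>\<sim>\<close> 50) where
  "u \<sim> w \<equiv> (u, w) \<in> parcs G"

lemma adj_sym: "u \<sim> w \<Longrightarrow> w \<sim> u"
  using pair_sym_arcs by (auto simp: symmetric_def dest: symD)

lemma not_adj_sym: "\<not> u \<sim> w \<Longrightarrow> \<not> w \<sim> u"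
  using adj_sym by blast

lemma adj_irrefl: "\<not> u \<sim> u"
  using pair_no_loops by force

lemma claw_free_iff:
  "induced_free claw G \<longleftrightarrow>
    \<not> (\<exists>c a b d. c \<sim> a \<and> c \<sim> b \<and> c \<sim> d \<and> a \<noteq> b \<and> a \<noteq> d \<and> b \<noteq> d \<and>
      \<not> a \<sim> b \<and> \<not> a \<sim> d \<and> \<not> b \<sim> d)" (is "_ \<longleftrightarrow> \<not> ?R")
proof -
  have "\<not> induced_free claw G \<longleftrightarrow> ?R"
    unfolding not_induced_free_iff_embedding[OF pair_wf_digraph_axioms pair_wf_claw]
  proof
    assume ?R
    then obtain c a b d where *: "c \<sim> a" "c \<sim> b" "c \<sim> d" "a \<noteq> b" "a \<noteq> d" "b \<noteq> d"
      "\<not> a \<sim> b" "\<not> a \<sim> d" "\<not> b \<sim> d" by blast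
    then have **: "c \<noteq> a" "c \<noteq> b" "c \<noteq> d" "\<not> b \<sim> a" "\<not> d \<sim> a" "\<not> d \<sim> b"
      "a \<sim> c" "b \<sim> c" "d \<sim> c"
      using adj_irrefl adj_sym by blast+
    let ?f = "(!) [c, a, b, d]"
    have "inj_on ?f (pverts claw)"
      using * ** by (intro inj_on_nth) (auto simp: claw_def)
    moreover have "?f ` pverts claw \<subseteq> pverts G"
      using * wellformed' by (auto simp: claw_def)
    moreover have "\<forall>u\<in>pverts claw. \<forall>w\<in>pverts claw. ((u, w) \<in> parcs claw) = (?f u \<sim> ?f w)"
      by (simp add: claw_def * ** adj_irrefl)
    ultimately show "\<exists>f. inj_on f (pverts claw) \<and> f ` pverts claw \<subseteq> pverts G \<and>
      (\<forall>u\<in>pverts claw. \<forall>w\<in>pverts claw. ((u, w) \<in> parcs claw) = (f u \<sim> f w))" by blast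
  next
    assume "\<exists>f. inj_on f (pverts claw) \<and> f ` pverts claw \<subseteq> pverts G \<and>
      (\<forall>u\<in>pverts claw. \<forall>w\<in>pverts claw. ((u, w) \<in> parcs claw) = (f u \<sim> f w))"
    then obtain f where f: "inj_on f (pverts claw)"
      "\<forall>u\<in>pverts claw. \<forall>w\<in>pverts claw. ((u, w) \<in> parcs claw) = (f u \<sim> f w)"
      by metis
    have "i \<in> pverts claw" if "i < 4" for i
      using that by (auto simp: claw_def)
    then have eqs: "f i = f j \<longleftrightarrow> i = j" "f i \<sim> f j \<longleftrightarrow> (i, j) \<in> parcs claw" if "i < 4" "j < 4" for i j
      using inj_on_eq_iff[OF f(1), of i j] f(2) that by blast+
    show ?R
      by (rule exI[of _ "f 0"], rule exI[of _ "f 1"], rule exI[of _ "f 2"], rule exI[of _ "f 3"],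
        simp add: claw_def eqs)
  qed
  then show ?thesis by blast
qed

lemma net_free_iff:
  "induced_free net G \<longleftrightarrow>
    \<not> (\<exists>x y z x' y' z'. distinct [x, y, z, x', y', z'] \<and>
      x \<sim> y \<and> y \<sim> z \<and> x \<sim> z \<and> x \<sim> x' \<and> y \<sim> y' \<and> z \<sim> z' \<and>
      \<not> x \<sim> y' \<and> \<not> x \<sim> z' \<and> \<not> y \<sim> x' \<and> \<not> y \<sim> z' \<and> \<not> z \<sim> x' \<and> \<not> z \<sim> y' \<and>
      \<not> x' \<sim> y' \<and> \<not> x' \<sim> z' \<and> \<not> y' \<sim> z')" (is "_ \<longleftrightarrow> \<not> ?R")
proof -
  have "\<not> induced_free net G \<longleftrightarrow> ?R"
    unfolding not_induced_free_iff_embedding[OF pair_wf_digraph_axioms pair_wf_net]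
  proof
    assume ?R
    then obtain x y z x' y' z' where *: "distinct [x, y, z, x', y', z']"
      "x \<sim> y" "y \<sim> z" "x \<sim> z" "x \<sim> x'" "y \<sim> y'" "z \<sim> z'"
      "\<not> x \<sim> y'" "\<not> x \<sim> z'" "\<not> y \<sim> x'" "\<not> y \<sim> z'" "\<not> z \<sim> x'" "\<not> z \<sim> y'"
      "\<not> x' \<sim> y'" "\<not> x' \<sim> z'" "\<not> y' \<sim> z'" by blast
    note ** = *(2-7)[THEN adj_sym] *(8-16)[THEN not_adj_sym]
    let ?f = "(!) [x, y, z, x', y', z']"
    have "inj_on ?f (pverts net)"
      using * ** by (intro inj_on_nth) (auto simp: net_def)
    moreover have "?f ` pverts net \<subseteq> pverts G"
      using * wellformed' by (auto simp: net_def)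
    moreover have "\<forall>u\<in>pverts net. \<forall>w\<in>pverts net. ((u, w) \<in> parcs net) = (?f u \<sim> ?f w)"
    proof (intro ballI)
      fix u w assume "u \<in> pverts net" "w \<in> pverts net"
      then have "u = 0 \<or> u = 1 \<or> u = 2 \<or> u = 3 \<or> u = 4 \<or> u = 5"
        "w = 0 \<or> w = 1 \<or> w = 2 \<or> w = 3 \<or> w = 4 \<or> w = 5" by (simp_all add: net_def)
      then show "((u, w) \<in> parcs net) = (?f u \<sim> ?f w)"
        by (elim disjE; hypsubst; simp add: net_def * ** adj_irrefl)
    qed
    ultimately show "\<exists>f. inj_on f (pverts net) \<and> f ` pverts net \<subseteq> pverts G \<and>
      (\<forall>u\<in>pverts net. \<forall>w\<in>pverts net. ((u, w) \<in> parcs net) = (f u \<sim> f w))" by blast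
  next
    assume "\<exists>f. inj_on f (pverts net) \<and> f ` pverts net \<subseteq> pverts G \<and>
      (\<forall>u\<in>pverts net. \<forall>w\<in>pverts net. ((u, w) \<in> parcs net) = (f u \<sim> f w))"
    then obtain f where f: "inj_on f (pverts net)"
      "\<forall>u\<in>pverts net. \<forall>w\<in>pverts net. ((u, w) \<in> parcs net) = (f u \<sim> f w)"
      by metis
    have "i \<in> pverts net" if "i < 6" for i
      using that by (auto simp: net_def)
    then have eqs: "f i = f j \<longleftrightarrow> i = j" "f i \<sim> f j \<longleftrightarrow> (i, j) \<in> parcs net" if "i < 6" "j < 6" for i j
      using inj_on_eq_iff[OF f(1), of i j] f(2) that by blast+
    show ?R
      by (rule exI[of _ "f 0"], rule exI[of _ "f 1"], rule exI[of _ "f 2"],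
        rule exI[of _ "f 3"], rule exI[of _ "f 4"], rule exI[of _ "f 5"],
        simp add: net_def eqs)
  qed
  then show ?thesis by blast
qed

section \<open>Components and separators\<close>

lemma arcs_ends_induce: "arcs_ends (G \<restriction> X) = {(u, w). u \<sim> w \<and> u \<in> X \<and> w \<in> X}"
  by (force simp: arcs_ends_conv)

lemma wf_induce: "wf_digraph (G \<restriction> X)"
  by (auto simp: wf_digraph_def)

lemma symmetric_induce: "symmetric (G \<restriction> X)"
  unfolding symmetric_def arcs_ends_induce by (auto intro: symI adj_sym)

text \<open>
  Keeping \<open>X\<close> explicit lets components of
  \<open>G - S\<close> and \<open>G - T\<close> be compared by monotonicity.
\<close>
definition component :: "'a set \<Rightarrow> 'a \<Rightarrow> 'a set" where
  "component X u = {w. u \<rightarrow>\<^sup>*\<^bsub>G \<restriction> X\<^esub> w}"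

lemma component_self: "u \<in> X \<Longrightarrow> u \<in> component X u"
  by (simp add: component_def reachable_def rtrancl_on_refl)

lemma component_subset: "component X u \<subseteq> X"
  by (auto simp: component_def elim: reachable_in_vertsE)

lemma component_step:
  assumes "w \<in> component X u" "w \<sim> z" "z \<in> X"
  shows "z \<in> component X u"
proof -
  have "w \<in> X" using assms(1) component_subset by blast
  then show ?thesis
    using assms unfolding component_def reachable_def arcs_ends_induce
    by (auto intro: rtrancl_on_into_rtrancl_on)
qed

lemma component_sym: "w \<in> component X u \<Longrightarrow> u \<in> component X w"
  unfolding component_def using symmetric_reachable[OF symmetric_induce] by blast

text \<open>
  The main way to bound a component from above: a set that contains \<open>u\<close> and that no edge inside \<open>X\<close>
  leaves.
\<close>
lemma component_least:
  assumes "u \<in> C" "\<And>w z. w \<in> C \<Longrightarrow> w \<in> X \<Longrightarrow> w \<sim> z \<Longrightarrow> z \<in> X \<Longrightarrow> z \<in> C"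
  shows "component X u \<subseteq> C"
proof
  fix w assume "w \<in> component X u"
  then have "(u, w) \<in> rtrancl_on X {(u, w). u \<sim> w \<and> u \<in> X \<and> w \<in> X}"
    unfolding component_def reachable_def arcs_ends_induce by simp
  then show "w \<in> C" by (induct rule: rtrancl_on_induct) (use assms in auto)
qed

lemma component_mono:
  assumes "X \<subseteq> Y" "u \<in> X"
  shows "component X u \<subseteq> component Y u"
  using assms by (intro component_least) (auto intro: component_self component_step)

lemma component_eq:
  assumes "w \<in> component X u"
  shows "component X w = component X u"
proof
  show "component X w \<subseteq> component X u"
    using assms by (intro component_least) (auto intro: component_step)
  show "component X u \<subseteq> component X w"
    using component_sym[OF assms] by (intro component_least) (auto intro: component_step)
qed

lemma component_disjoint_or_eq:
  "z \<in> component X u \<Longrightarrow> z \<in> component X w \<Longrightarrow> component X u = component X w"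
  using component_eq by metis

lemma not_adj_components:
  assumes "a \<in> component X u" "b \<in> component X w" "component X u \<noteq> component X w"
  shows "\<not> a \<sim> b" "a \<noteq> b"
  using assms component_step component_subset component_disjoint_or_eq by blast+

lemma sccs_verts_induce: "pre_digraph.sccs_verts (G \<restriction> X) = component X ` X"
proof -
  have "pre_digraph.scc_of (G \<restriction> X) u = component X u" for u
    using component_sym by (auto simp: pre_digraph.scc_of_def component_def)
  then show ?thesis
    using wf_digraph.sccs_verts_conv_scc_of[OF wf_induce] by simp
qed

lemma separator_iff:
  "separator G S \<longleftrightarrow> S \<subseteq> pverts G \<and>
    (\<exists>u \<in> pverts G - S. \<exists>w \<in> pverts G - S. component (pverts G - S) u \<noteq> component (pverts G - S) w)"
  unfolding separator_def delete_verts_def by (auto simp: sccs_verts_induce)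

lemma not_separator_component:
  assumes "\<not> separator G S" "S \<subseteq> pverts G" "u \<in> pverts G - S"
  shows "component (pverts G - S) u = pverts G - S"
  using assms component_subset component_self unfolding separator_iff by blast

text \<open>
  Connectedness refers to the symmetric closure of the arcs, which adds no arc here.
\<close>
lemma connected_not_separator_empty:
  assumes "Digraph_Component.connected G"
  shows "\<not> separator G {}"
proof -
  have "u \<rightarrow>\<^sup>*\<^bsub>G\<^esub> w" if "u \<in> pverts G" "w \<in> pverts G" for u w
    using assms that reachable_mk_symmetric_eq[OF pair_sym_arcs]
    by (auto simp: connected_def strongly_connected_def)
  moreover have "{(u, w). u \<sim> w \<and> u \<in> pverts G \<and> w \<in> pverts G} = parcs G"
    using wellformed' by auto
  ultimately have "w \<in> component (pverts G) u" if "u \<in> pverts G" "w \<in> pverts G" for u w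
    using that by (simp add: component_def reachable_def arcs_ends_induce)
  then show ?thesis
    using component_eq unfolding separator_iff by fastforce
qed

section \<open>Distance classes\<close>

lemma level_subset: "verts_at_dist (G \<restriction> X) v i \<subseteq> X"
  by (auto simp: verts_at_dist_def)

lemma level_0:
  assumes "v \<in> X" shows "verts_at_dist (G \<restriction> X) v 0 = {v}"
proof -
  interpret X: wf_digraph "G \<restriction> X" by (rule wf_induce)
  show ?thesis
    unfolding verts_at_dist_iff[OF wf_induce] using assms by (auto simp: X.awalk_Nil_iff)
qed

lemma level_unique:
  "u \<in> verts_at_dist (G \<restriction> X) v i \<Longrightarrow> u \<in> verts_at_dist (G \<restriction> X) v j \<Longrightarrow> i = j"
  by (simp add: verts_at_dist_def)

text \<open>
  Appending the edge to a shortest walk to \<open>w\<close> gives a walk to \<open>u\<close> of length \<open>i + 1\<close>; a shortest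
  walk to \<open>u\<close> is no longer.
\<close>
lemma level_step:
  assumes "w \<in> verts_at_dist (G \<restriction> X) v i" "w \<sim> u" "u \<in> X"
  obtains j where "j \<le> Suc i" "u \<in> verts_at_dist (G \<restriction> X) v j"
proof -
  interpret X: wf_digraph "G \<restriction> X" by (rule wf_induce)
  obtain p where p: "X.awalk v p w" "length p = i" and "w \<in> X"
    using assms(1) unfolding verts_at_dist_iff[OF wf_induce] by auto
  have "X.awalk w [(w, u)] u"
    using assms(2,3) \<open>w \<in> X\<close> by (simp add: X.awalk_Cons_iff X.awalk_Nil_iff)
  then have walk: "X.awalk v (p @ [(w, u)]) u"
    using p by (auto intro: X.awalk_appendI)
  define q where "q = arg_min length (\<lambda>p. X.awalk v p u)"
  have q: "X.awalk v q u" and min: "length q \<le> length p" if "X.awalk v p u" for p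
    unfolding q_def using arg_min_nat_lemma[of "\<lambda>p. X.awalk v p u" _ length, OF that] that by blast+
  have "length q \<le> Suc i" using min[OF walk] p(2) by simp
  moreover have "u \<in> verts_at_dist (G \<restriction> X) v (length q)"
    unfolding verts_at_dist_iff[OF wf_induce] using q[OF walk] min assms(3) by auto
  ultimately show ?thesis by (rule that)
qed

text \<open>
  All but the last edge of a shortest walk is a shortest walk to the penultimate vertex.
\<close>
lemma level_pred:
  assumes "u \<in> verts_at_dist (G \<restriction> X) v (Suc i)"
  obtains w where "w \<in> verts_at_dist (G \<restriction> X) v i" "w \<sim> u"
proof -
  interpret X: wf_digraph "G \<restriction> X" by (rule wf_induce)
  obtain p where p: "X.awalk v p u" "length p = Suc i"
    and min: "\<And>q. X.awalk v q u \<Longrightarrow> Suc i \<le> length q"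
    using assms unfolding verts_at_dist_iff[OF wf_induce] by auto
  obtain q e where q: "p = q @ [e]" "length q = i"
    using p(2) by (cases p rule: rev_cases) auto
  let ?w = "X.awlast v q"
  have walks: "X.awalk v q ?w" "X.awalk ?w [e] u"
    using p(1) unfolding q X.awalk_append_iff by auto
  have "i \<le> length r" if "X.awalk v r ?w" for r
    using min[OF X.awalk_appendI[OF that walks(2)]] by simp
  then have "?w \<in> verts_at_dist (G \<restriction> X) v i"
    using walks q(2) X.awlast_in_verts unfolding verts_at_dist_iff[OF wf_induce] by auto
  moreover have "?w \<sim> u" using walks(2) by (auto simp: X.awalk_Cons_iff X.awalk_Nil_iff)
  ultimately show ?thesis by (rule that)
qed

lemma level_not_adj:
  assumes "w \<in> verts_at_dist (G \<restriction> X) v i" "u \<in> verts_at_dist (G \<restriction> X) v j" "Suc i < j"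
  shows "\<not> w \<sim> u"
proof
  assume "w \<sim> u"
  moreover have "u \<in> X" using assms(2) level_subset by blast
  ultimately obtain l where "l \<le> Suc i" "u \<in> verts_at_dist (G \<restriction> X) v l"
    by (rule level_step[OF assms(1)])
  then show False using level_unique[OF assms(2), of l] assms(3) by simp
qed

lemma level_1I:
  assumes "v \<in> X" "u \<in> X" "v \<sim> u"
  shows "u \<in> verts_at_dist (G \<restriction> X) v 1"
proof -
  have "v \<in> verts_at_dist (G \<restriction> X) v 0" using level_0[OF assms(1)] by simp
  then obtain j where j: "j \<le> Suc 0" "u \<in> verts_at_dist (G \<restriction> X) v j"
    using assms(3,2) by (rule level_step)
  have "u \<noteq> v" using assms(3) adj_irrefl by blast
  then show ?thesis using j level_0[OF assms(1)] by (cases j) auto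
qed

lemma level_2I:
  assumes "v \<in> X" "u \<in> X" "w \<in> X" "v \<sim> u" "u \<sim> w" "w \<noteq> v" "\<not> v \<sim> w"
  shows "w \<in> verts_at_dist (G \<restriction> X) v 2"
proof -
  obtain j where j: "j \<le> 2" "w \<in> verts_at_dist (G \<restriction> X) v j"
    by (rule level_step[OF level_1I[OF assms(1,2,4)] assms(5,3)]) (simp add: numeral_2_eq_2)
  have "j \<noteq> 0" using j(2) assms(6) level_0[OF assms(1)] by (cases j) auto
  moreover have "j \<noteq> 1"
  proof
    assume "j = 1"
    then have "w \<in> verts_at_dist (G \<restriction> X) v (Suc 0)" using j(2) by simp
    then obtain t where "t \<in> verts_at_dist (G \<restriction> X) v 0" "t \<sim> w" by (rule level_pred)
    then show False using level_0[OF assms(1)] assms(7) by simp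
  qed
  ultimately have "j = 2" using j(1) by simp
  then show ?thesis using j by simp
qed

text \<open>
  With \<open>X = V(G) - S\<close>, the graph \<open>H = G - (S - {v})\<close> is induced by \<open>X \<union> {v}\<close>, and the components
  of \<open>H - v\<close> are those of \<open>G - S\<close>; iterated restrictions collapse to a single restriction of \<open>G\<close>.
\<close>
lemma distance_2_complete_iff:
  assumes "v \<in> S" "S \<subseteq> pverts G"
  shows "distance_2_complete (delete_verts G (S - {v})) v \<longleftrightarrow>
    card (component (pverts G - S) ` (pverts G - S)) = 2 \<and>
    (\<forall>x \<in> pverts G - S. \<forall>i.
      \<forall>u \<in> verts_at_dist (G \<restriction> insert v (component (pverts G - S) x)) v i.
      \<forall>w \<in> verts_at_dist (G \<restriction> insert v (component (pverts G - S) x)) v i. u \<noteq> w \<longrightarrow> u \<sim> w)"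
proof -
  define X where "X = pverts G - S"
  have H: "delete_verts G (S - {v}) = G \<restriction> insert v X"
  proof -
    have "pverts G - (S - {v}) = insert v X" using assms by (auto simp: X_def)
    then show ?thesis by (simp add: delete_verts_def)
  qed
  have restr: "(G \<restriction> Z) \<restriction> Y = G \<restriction> Y" if "Y \<subseteq> Z" for Y Z
    using that by (auto simp: induce_subgraph_def)
  have HX: "delete_verts (G \<restriction> insert v X) {v} = G \<restriction> X"
  proof -
    have "insert v X - {v} = X" using assms by (auto simp: X_def)
    then show ?thesis by (simp add: delete_verts_def restr subset_insertI)
  qed
  have lev: "(G \<restriction> insert v X) \<restriction> verts_at_dist ((G \<restriction> insert v X) \<restriction> insert v (component X x)) v i
      = G \<restriction> verts_at_dist (G \<restriction> insert v (component X x)) v i" for x i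
  proof -
    have sub: "insert v (component X x) \<subseteq> insert v X" using component_subset by auto
    show ?thesis
      using restr[OF sub] restr[OF order_trans[OF level_subset sub]] by simp
  qed
  have complete: "complete_graph (G \<restriction> Y) \<longleftrightarrow> (\<forall>u \<in> Y. \<forall>w \<in> Y. u \<noteq> w \<longrightarrow> u \<sim> w)" for Y
    by (auto simp: complete_graph_def arcs_ends_induce)
  show ?thesis
    unfolding distance_2_complete_def H HX sccs_verts_induce X_def[symmetric]
    by (simp add: lev complete)
qed

section \<open>Claw-free and net-free graphs\<close>

lemma minimal_separatorD:
  assumes "minimal_separator G S"
  shows "separator G S" "S \<subseteq> pverts G" "T \<subset> S \<Longrightarrow> \<not> separator G T"
  using assms unfolding minimal_separator_def by (simp, simp add: separator_def, blast)

text \<open>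
  Putting \<open>v\<close> back makes the graph connected, so \<open>v\<close> must reach every component.
\<close>
lemma minimal_separator_full:
  assumes "minimal_separator G S" "v \<in> S" "x \<in> pverts G - S"
  shows "\<exists>a \<in> component (pverts G - S) x. v \<sim> a"
proof (rule ccontr)
  let ?C = "component (pverts G - S) x" and ?Y = "pverts G - (S - {v})"
  assume contra: "\<not> ?thesis"
  have no: "\<not> a \<sim> v" if "a \<in> ?C" for a
    using that contra adj_sym[of a v] by blast
  have S: "S \<subseteq> pverts G" by (rule minimal_separatorD(2)) fact
  have "S - {v} \<subset> S" using assms(2) by blast
  then have "\<not> separator G (S - {v})" by (rule minimal_separatorD(3)[OF assms(1)])
  then have "component ?Y x = ?Y"
    by (rule not_separator_component) (use assms(3) S in auto)
  moreover have "component ?Y x \<subseteq> ?C"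
  proof (rule component_least)
    show "x \<in> ?C" using assms(3) by (rule component_self)
    fix w z assume wz: "w \<in> ?C" "w \<sim> z" "z \<in> ?Y"
    then have "z \<noteq> v" using no by blast
    then have "z \<in> pverts G - S" using wz(3) by simp
    then show "z \<in> ?C" by (rule component_step[OF wz(1,2)])
  qed
  moreover have "v \<in> ?Y" using assms(2) S by auto
  ultimately have "v \<in> pverts G - S" using component_subset[of "pverts G - S" x] by auto
  then show False using assms(2) by simp
qed

text \<open>
  By the preceding lemma \<open>v\<close> has a neighbour in each component, and three components would give a
  claw centred at \<open>v\<close>.
\<close>
lemma claw_free_two_components:
  assumes claw: "induced_free claw G" and S: "minimal_separator G S" "v \<in> S"
  shows "card (component (pverts G - S) ` (pverts G - S)) = 2"
proof -
  let ?X = "pverts G - S"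
  obtain u w where uw: "u \<in> ?X" "w \<in> ?X" "component ?X u \<noteq> component ?X w"
    using minimal_separatorD(1)[OF S(1)] unfolding separator_iff by blast
  have "component ?X t = component ?X u \<or> component ?X t = component ?X w" if t: "t \<in> ?X" for t
  proof (rule ccontr)
    assume neq: "\<not> ?thesis"
    obtain a where a: "a \<in> component ?X u" "v \<sim> a"
      using minimal_separator_full[OF S uw(1)] by blast
    obtain b where b: "b \<in> component ?X w" "v \<sim> b"
      using minimal_separator_full[OF S uw(2)] by blast
    obtain d where d: "d \<in> component ?X t" "v \<sim> d"
      using minimal_separator_full[OF S t] by blast
    have "\<not> a \<sim> b" "a \<noteq> b" "\<not> a \<sim> d" "a \<noteq> d" "\<not> b \<sim> d" "b \<noteq> d"
      using not_adj_components[OF a(1) b(1)] not_adj_components[OF a(1) d(1)]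
        not_adj_components[OF b(1) d(1)] uw(3) neq by auto
    then show False using claw a(2) b(2) d(2) unfolding claw_free_iff by blast
  qed
  then have "component ?X ` ?X = {component ?X u, component ?X w}"
    using uw(1,2) by auto
  then show ?thesis using uw(3) by simp
qed

text \<open>
  A neighbour of \<open>w\<close> that lies strictly closer to \<open>v\<close> sees none of the classes beyond that of \<open>w\<close>.
  For \<open>w = v\<close> there is no closer vertex in \<open>C \<union> {v}\<close>; the neighbour \<open>d\<close> of \<open>v\<close> outside \<open>C\<close> takes
  its place, so that the induction below need not treat small distances separately.
\<close>
lemma level_outer_neighbour:
  assumes d: "v \<sim> d" "d \<notin> insert v C" "\<And>x. x \<in> C \<Longrightarrow> \<not> d \<sim> x"
    and w: "w \<in> verts_at_dist (G \<restriction> insert v C) v i"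
  shows "\<exists>p. p \<sim> w \<and> (\<forall>j>i. \<forall>u \<in> verts_at_dist (G \<restriction> insert v C) v j. p \<noteq> u \<and> \<not> p \<sim> u)"
proof (cases i)
  case 0
  then have "w = v" using w level_0 by blast
  moreover have "d \<noteq> u \<and> \<not> d \<sim> u"
    if "i < j" "u \<in> verts_at_dist (G \<restriction> insert v C) v j" for j u
  proof -
    have "u \<in> insert v C" using that(2) level_subset by blast
    moreover have "u \<noteq> v" using that 0 level_unique[of u "insert v C" v 0 j] level_0[of v "insert v C"] by auto
    ultimately show ?thesis using d by auto
  qed
  ultimately show ?thesis using adj_sym[OF d(1)] by blast
next
  case (Suc k)
  then obtain p where p: "p \<in> verts_at_dist (G \<restriction> insert v C) v k" "p \<sim> w"
    using w level_pred[of w "insert v C" v k] by blast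
  have "p \<noteq> u \<and> \<not> p \<sim> u"
    if "i < j" "u \<in> verts_at_dist (G \<restriction> insert v C) v j" for j u
    using that p(1) Suc level_unique[of u "insert v C" v k j] level_not_adj[OF p(1) that(2)] by auto
  then show ?thesis using p(2) by blast
qed

text \<open>
  Induction on the distance. Let \<open>x, y\<close> at distance \<open>i + 1\<close> be non-adjacent. A common neighbour at
  distance \<open>i\<close> is, with its outer neighbour, the centre of a claw. Otherwise \<open>x, y\<close> have distinct
  private neighbours \<open>x', y'\<close> at distance \<open>i\<close>, adjacent by induction. A neighbour \<open>w\<close> of \<open>x'\<close> at
  distance \<open>i - 1\<close> either misses \<open>y'\<close>, which makes \<open>x'\<close> the centre of a claw with leaves \<open>x, y', w\<close>,
  or completes the triangle \<open>w, x', y'\<close> of a net with pendants \<open>p, x, y\<close>, where \<open>p\<close> is an outer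
  neighbour of \<open>w\<close>.
\<close>
lemma levels_complete:
  assumes claw: "induced_free claw G" and net: "induced_free net G"
    and d: "v \<sim> d" "d \<notin> insert v C" "\<And>x. x \<in> C \<Longrightarrow> \<not> d \<sim> x"
    and xy: "x \<in> verts_at_dist (G \<restriction> insert v C) v i" "y \<in> verts_at_dist (G \<restriction> insert v C) v i" "x \<noteq> y"
  shows "x \<sim> y"
  using xy
proof (induction i arbitrary: x y)
  case 0
  then show ?case using level_0[of v "insert v C"] by auto
next
  case (Suc i)
  let ?L = "verts_at_dist (G \<restriction> insert v C) v"
  have levels_disjoint: "a \<noteq> b" if "a \<in> ?L m" "b \<in> ?L n" "m \<noteq> n" for a b m n
    using that level_unique by blast
  show ?case
  proof (rule ccontr)
    assume nxy: "\<not> x \<sim> y"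
    have no_common: "\<not> (z \<sim> x \<and> z \<sim> y)" if z: "z \<in> ?L i" for z
    proof
      assume "z \<sim> x \<and> z \<sim> y"
      moreover obtain p where p: "p \<sim> z" "\<forall>j>i. \<forall>u \<in> ?L j. p \<noteq> u \<and> \<not> p \<sim> u"
        using level_outer_neighbour[OF d z] by blast
      moreover have "p \<noteq> x" "p \<noteq> y" "\<not> p \<sim> x" "\<not> p \<sim> y"
        using p(2) Suc.prems(1,2) lessI by blast+
      ultimately show False
        using claw nxy Suc.prems(3) adj_sym[OF p(1)] not_adj_sym[of p] unfolding claw_free_iff by metis
    qed
    obtain x' where x': "x' \<in> ?L i" "x' \<sim> x" using Suc.prems(1) by (rule level_pred)
    obtain y' where y': "y' \<in> ?L i" "y' \<sim> y" using Suc.prems(2) by (rule level_pred)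
    have cross: "\<not> x' \<sim> y" "\<not> y' \<sim> x" "x' \<noteq> y'" using no_common x' y' by auto
    then have adj': "x' \<sim> y'" using Suc.IH x' y' by blast
    have "i \<noteq> 0" using x'(1) y'(1) cross(3) level_0[of v "insert v C"] by (cases i) auto
    then obtain k where k: "i = Suc k" by (cases i) auto
    obtain w where w: "w \<in> ?L k" "w \<sim> x'" using x'(1) unfolding k by (rule level_pred)
    have "\<not> w \<sim> x" "\<not> w \<sim> y"
      using level_not_adj[OF w(1) Suc.prems(1)] level_not_adj[OF w(1) Suc.prems(2)] k by simp_all
    moreover have "w \<noteq> x" "w \<noteq> y" "w \<noteq> x'" "w \<noteq> y'" "x' \<noteq> x" "x' \<noteq> y" "y' \<noteq> x" "y' \<noteq> y"
      using levels_disjoint[OF w(1) Suc.prems(1)] levels_disjoint[OF w(1) Suc.prems(2)]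
        levels_disjoint[OF w(1) x'(1)] levels_disjoint[OF w(1) y'(1)]
        levels_disjoint[OF x'(1) Suc.prems(1)] levels_disjoint[OF x'(1) Suc.prems(2)]
        levels_disjoint[OF y'(1) Suc.prems(1)] levels_disjoint[OF y'(1) Suc.prems(2)]
      by (simp_all add: k)
    ultimately have wxy: "\<not> w \<sim> x" "\<not> w \<sim> y" "w \<noteq> x" "w \<noteq> y" "w \<noteq> x'" "w \<noteq> y'"
      "x' \<noteq> x" "x' \<noteq> y" "y' \<noteq> x" "y' \<noteq> y" by auto
    show False
    proof (cases "w \<sim> y'")
      case True
      obtain p where p: "p \<sim> w" "\<forall>j>k. \<forall>u \<in> ?L j. p \<noteq> u \<and> \<not> p \<sim> u"
        using level_outer_neighbour[OF d w(1)] by blast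
      have far: "p \<noteq> u \<and> \<not> p \<sim> u" if "u \<in> ?L j" "k < j" for u j
        using p(2) that by blast
      have px: "p \<noteq> x \<and> \<not> p \<sim> x" "p \<noteq> y \<and> \<not> p \<sim> y" "p \<noteq> x' \<and> \<not> p \<sim> x'" "p \<noteq> y' \<and> \<not> p \<sim> y'"
        using far[OF Suc.prems(1)] far[OF Suc.prems(2)] far[OF x'(1)] far[OF y'(1)]
        by (simp_all add: k)
      have "w \<noteq> p" using p(1) adj_irrefl by blast
      have "distinct [w, x', y', p, x, y]"
        using px wxy cross(3) Suc.prems(3) \<open>w \<noteq> p\<close> by auto
      moreover have "w \<sim> p" "\<not> x' \<sim> p" "\<not> y' \<sim> p"
        using adj_sym[OF p(1)] px not_adj_sym[of p] by blast+
      ultimately show False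
        using net True w(2) adj' x'(2) y'(2) wxy(1,2) cross(1,2) px nxy
        unfolding net_free_iff by blast
    next
      case False
      have "\<not> y' \<sim> w" "\<not> x \<sim> y'" "\<not> x \<sim> w" "x' \<sim> w"
        using not_adj_sym[OF False] not_adj_sym[OF cross(2)] not_adj_sym[OF wxy(1)] adj_sym[OF w(2)] .
      then show False
        using claw x'(2) adj' wxy(3,6,9) unfolding claw_free_iff by metis
    qed
  qed
qed

lemma claw_net_free_distance_2_complete:
  assumes "induced_free claw G" "induced_free net G" and S: "minimal_separator G S" "v \<in> S"
  shows "distance_2_complete (delete_verts G (S - {v})) v"
proof -
  let ?X = "pverts G - S"
  have sub: "S \<subseteq> pverts G" by (rule minimal_separatorD(2)) fact
  have card: "card (component ?X ` ?X) = 2" by (rule claw_free_two_components) fact+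
  have "u \<sim> w" if x: "x \<in> ?X" and uw: "u \<in> verts_at_dist (G \<restriction> insert v (component ?X x)) v i"
    "w \<in> verts_at_dist (G \<restriction> insert v (component ?X x)) v i" "u \<noteq> w" for x i u w
  proof -
    obtain t where t: "t \<in> ?X" "component ?X t \<noteq> component ?X x"
      using minimal_separatorD(1)[OF S(1)] unfolding separator_iff by metis
    obtain d where d: "d \<in> component ?X t" "v \<sim> d"
      using minimal_separator_full[OF S t(1)] by blast
    have "d \<notin> component ?X x" using t(2) d(1) component_disjoint_or_eq by blast
    moreover have "d \<noteq> v" using d(2) adj_irrefl by blast
    moreover have "\<not> d \<sim> y" if "y \<in> component ?X x" for y
      using not_adj_components(1)[OF d(1) that t(2)] .
    ultimately show ?thesis
      using levels_complete[OF assms(1,2) d(2) _ _ uw] by blast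
  qed
  then show ?thesis
    unfolding distance_2_complete_iff[OF S(2) sub] using card by blast
qed

section \<open>Graphs whose minimal separators are distance-2-complete\<close>

lemma exists_minimal_separator:
  assumes "finite S" "separator G S"
  obtains T where "T \<subseteq> S" "minimal_separator G T"
proof -
  have "finite {T. T \<subseteq> S \<and> separator G T}" "S \<in> {T. T \<subseteq> S \<and> separator G T}"
    using assms by auto
  from finite_has_minimal2[OF this] obtain T where "T \<subseteq> S" "separator G T"
    "\<And>U. U \<subseteq> S \<Longrightarrow> separator G U \<Longrightarrow> U \<subseteq> T \<Longrightarrow> T = U" by auto
  then show ?thesis
    by (intro that[of T]) (auto simp: minimal_separator_def)
qed

definition separators_distance_2_complete :: bool where
  "separators_distance_2_complete \<longleftrightarrow> (\<forall>S. finite S \<and> minimal_separator G S \<longrightarrow>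
      (\<forall>v \<in> S. distance_2_complete (delete_verts G (S - {v})) v))"

lemma separator_levels:
  assumes "separators_distance_2_complete" "finite S" "minimal_separator G S" "v \<in> S"
  shows "card (component (pverts G - S) ` (pverts G - S)) = 2"
    and "x \<in> pverts G - S \<Longrightarrow> u \<in> verts_at_dist (G \<restriction> insert v (component (pverts G - S) x)) v i \<Longrightarrow>
      w \<in> verts_at_dist (G \<restriction> insert v (component (pverts G - S) x)) v i \<Longrightarrow> u \<noteq> w \<Longrightarrow> u \<sim> w"
proof -
  have "S \<subseteq> pverts G" by (rule minimal_separatorD(2)) fact
  moreover have "distance_2_complete (delete_verts G (S - {v})) v"
    using assms by (auto simp: separators_distance_2_complete_def)
  ultimately show "card (component (pverts G - S) ` (pverts G - S)) = 2"
    and "x \<in> pverts G - S \<Longrightarrow> u \<in> verts_at_dist (G \<restriction> insert v (component (pverts G - S) x)) v i \<Longrightarrow>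
      w \<in> verts_at_dist (G \<restriction> insert v (component (pverts G - S) x)) v i \<Longrightarrow> u \<noteq> w \<Longrightarrow> u \<sim> w"
    using distance_2_complete_iff[OF assms(4)] by blast+
qed

text \<open>
  The neighbours of \<open>v\<close> in a component are its distance class 1.
\<close>
lemma separator_neighbours_adj:
  assumes "separators_distance_2_complete" "finite S" "minimal_separator G S" "v \<in> S"
    and "x \<in> pverts G - S" "a \<in> component (pverts G - S) x" "b \<in> component (pverts G - S) x"
    and "v \<sim> a" "v \<sim> b" "a \<noteq> b"
  shows "a \<sim> b"
  by (rule separator_levels(2)[OF assms(1-5) _ _ assms(10), of 1]; rule level_1I)
    (use assms(6-9) in simp_all)

text \<open>
  In an arbitrary graph two components that are both adjacent to all of \<open>S\<close> need not make \<open>S\<close>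
  minimal, since a third component may attach to a proper subset \<open>T\<close> of \<open>S\<close> only. Under the hypothesis
  on separators no proper subset \<open>T\<close> of \<open>S\<close> can be a minimal separator: a vertex \<open>s \<in> S - T\<close> merges
  the two components in \<open>G - T\<close>, and then any \<open>v \<in> T\<close> has two non-adjacent neighbours in one
  component of \<open>G - T\<close>, one from each of the merged components.
\<close>
lemma two_full_components_minimal:
  assumes conn: "Digraph_Component.connected G" and P: "separators_distance_2_complete"
    and S: "finite S" "S \<subseteq> pverts G"
    and ad: "a \<in> pverts G - S" "d \<in> pverts G - S"
      "component (pverts G - S) a \<noteq> component (pverts G - S) d"
    and full: "\<And>s. s \<in> S \<Longrightarrow> \<exists>x \<in> component (pverts G - S) a. s \<sim> x"
      "\<And>s. s \<in> S \<Longrightarrow> \<exists>x \<in> component (pverts G - S) d. s \<sim> x"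
  shows "minimal_separator G S"
proof -
  let ?A = "component (pverts G - S) a" and ?D = "component (pverts G - S) d"
  have "separator G S" using S ad by (auto simp: separator_iff)
  then obtain T where T: "T \<subseteq> S" "minimal_separator G T"
    using exists_minimal_separator S(1) by blast
  have "T = S"
  proof (rule ccontr)
    assume "T \<noteq> S"
    then obtain s where s: "s \<in> S" "s \<notin> T" using T(1) by blast
    have "T \<noteq> {}"
      using minimal_separatorD(1)[OF T(2)] connected_not_separator_empty[OF conn] by blast
    then obtain v where v: "v \<in> T" by blast
    let ?Y = "pverts G - T"
    have sub: "pverts G - S \<subseteq> ?Y" using T(1) by blast
    have sY: "s \<in> ?Y" using s S(2) by blast
    \<comment> \<open>Any component of \<open>G - S\<close> that \<open>s\<close> is adjacent to becomes part of the component of \<open>s\<close> in \<open>G - T\<close>.\<close>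
    have joined: "component (pverts G - S) x \<subseteq> component ?Y s"
      if "y \<in> component (pverts G - S) x" "s \<sim> y" for x y
    proof -
      have y: "y \<in> pverts G - S" using that(1) component_subset by blast
      then have "y \<in> component ?Y s"
        using sub by (intro component_step[OF component_self[OF sY] that(2)]) blast
      then show ?thesis
        using component_mono[OF sub y] component_eq[OF that(1)] component_eq[of y ?Y s] by simp
    qed
    have AD: "?A \<subseteq> component ?Y s" "?D \<subseteq> component ?Y s"
      using full[OF s(1)] joined by blast+
    obtain a' d' where a'd': "a' \<in> ?A" "v \<sim> a'" "d' \<in> ?D" "v \<sim> d'"
      using full[of v] v T(1) by blast
    have "\<not> a' \<sim> d'" "a' \<noteq> d'"
      using not_adj_components[OF a'd'(1,3) ad(3)] by auto
    moreover have "a' \<sim> d'"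
      using separator_neighbours_adj[OF P _ T(2) v sY _ _ a'd'(2,4)] a'd' AD
        \<open>a' \<noteq> d'\<close> finite_subset[OF T(1) S(1)] by blast
    ultimately show False by blast
  qed
  then show ?thesis using T(2) by simp
qed

lemma finite_neighbours:
  assumes "locally_finite G" "u \<in> pverts G"
  shows "finite {w. u \<sim> w}"
proof -
  have "{w. u \<sim> w} = snd ` out_arcs G u" by (force simp: out_arcs_def)
  then show ?thesis using assms by (simp add: locally_finite_def)
qed

text \<open>
  Let \<open>N\<close> be the neighbourhood of the connected set \<open>K\<close> and \<open>D\<close> the component of \<open>d\<close> in \<open>G - N\<close>. The
  neighbours of \<open>D\<close> in \<open>N\<close> form a set \<open>S\<close>, every vertex of which is adjacent to \<open>K\<close> and to \<open>D\<close>; it is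
  minimal (\<open>two_full_components_minimal\<close>). A common neighbour \<open>x\<close> of \<open>K\<close> and \<open>d\<close> lies in \<open>S\<close>. Local
  finiteness makes \<open>N\<close>, and with it \<open>S\<close>, finite.
\<close>
lemma exists_separating_minimal_separator:
  assumes conn: "Digraph_Component.connected G" and fin: "locally_finite G"
    and P: "separators_distance_2_complete"
    and K: "finite K" "K \<subseteq> pverts G" "k \<in> K" "K \<subseteq> component K k"
    and d: "d \<in> pverts G" "d \<notin> K" "\<And>y. y \<in> K \<Longrightarrow> \<not> y \<sim> d"
    and x: "x \<notin> K" "y \<in> K" "y \<sim> x" "x \<sim> d"
  obtains S where "finite S" "minimal_separator G S" "x \<in> S"
    "\<And>s. s \<in> S \<Longrightarrow> s \<notin> K \<and> (\<exists>y \<in> K. y \<sim> s)" "d \<in> pverts G - S"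
    "K \<subseteq> component (pverts G - S) k"
    "component (pverts G - S) k \<noteq> component (pverts G - S) d"
proof -
  define N where "N = {w. \<exists>y \<in> K. y \<sim> w} - K"
  define D where "D = component (pverts G - N) d"
  define S where "S = {n \<in> N. \<exists>e \<in> D. n \<sim> e}"
  have "finite (\<Union>y \<in> K. {w. y \<sim> w})" using K(1,2) finite_neighbours[OF fin] by blast
  then have finS: "finite S" by (rule finite_subset[rotated]) (auto simp: S_def N_def)
  have SV: "S \<subseteq> pverts G" using wellformed' by (auto simp: S_def N_def)
  have dN: "d \<in> pverts G - N" using d by (auto simp: N_def)
  then have dD: "d \<in> D" unfolding D_def by (rule component_self)
  have xS: "x \<in> S" using x dD by (auto simp: S_def N_def)
  have dS: "d \<in> pverts G - S" using dN by (auto simp: S_def)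
  \<comment> \<open>A walk from \<open>d\<close> can enter \<open>K\<close> only through \<open>N\<close>.\<close>
  have "D \<subseteq> - K"
    unfolding D_def
  proof (rule component_least)
    show "d \<in> - K" using d(2) by simp
    fix w z assume wz: "w \<in> - K" "w \<in> pverts G - N" "w \<sim> z" "z \<in> pverts G - N"
    then show "z \<in> - K" using adj_sym[OF wz(3)] by (auto simp: N_def)
  qed
  \<comment> \<open>Deleting only \<open>S\<close> instead of \<open>N\<close> does not enlarge \<open>D\<close>, since \<open>S\<close> holds all its neighbours in \<open>N\<close>.\<close>
  have D: "component (pverts G - S) d = D"
  proof
    show "component (pverts G - S) d \<subseteq> D"
    proof (rule component_least[OF dD])
      fix w z assume wz: "w \<in> D" "w \<sim> z" "z \<in> pverts G - S"
      then have "z \<notin> N" using adj_sym[OF wz(2)] by (auto simp: S_def)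
      then have "z \<in> pverts G - N" using wz(3) by simp
      then show "z \<in> D" unfolding D_def by (rule component_step[OF wz(1)[unfolded D_def] wz(2)])
    qed
    show "D \<subseteq> component (pverts G - S) d"
      unfolding D_def using dN by (intro component_mono) (auto simp: S_def)
  qed
  have KS: "K \<subseteq> pverts G - S" using K(2) by (auto simp: S_def N_def)
  then have KA: "K \<subseteq> component (pverts G - S) k"
    using K(3,4) component_mono[OF KS] by blast
  have neq: "component (pverts G - S) k \<noteq> component (pverts G - S) d"
    using KA K(3) \<open>D \<subseteq> - K\<close> unfolding D by blast
  have "minimal_separator G S"
  proof (rule two_full_components_minimal[OF conn P finS SV _ dS neq])
    show "k \<in> pverts G - S" using K(3) KS by blast
    fix s assume "s \<in> S"
    then obtain y where "y \<in> K" "y \<sim> s" by (auto simp: S_def N_def)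
    then show "\<exists>x \<in> component (pverts G - S) k. s \<sim> x"
      using KA adj_sym[of y s] by blast
    show "\<exists>x \<in> component (pverts G - S) d. s \<sim> x"
      unfolding D using \<open>s \<in> S\<close> by (auto simp: S_def)
  qed
  then show ?thesis
    by (rule that[OF finS _ xS _ dS KA neq]) (auto simp: S_def N_def)
qed

text \<open>
  Separate the leaf \<open>d\<close> of a claw from the leaf \<open>a\<close> by a minimal \<open>S\<close> inside the neighbourhood of
  \<open>a\<close>. The centre \<open>c\<close> is in \<open>S\<close>, the third leaf \<open>b\<close> is not. There are only two components, so \<open>b\<close>
  shares one with \<open>a\<close> or with \<open>d\<close>, and both are then neighbours of \<open>c\<close> in the same component.
\<close>
lemma separators_complete_claw_free:
  assumes "Digraph_Component.connected G" "locally_finite G" "separators_distance_2_complete"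
  shows "induced_free claw G"
  unfolding claw_free_iff
proof
  assume "\<exists>c a b d. c \<sim> a \<and> c \<sim> b \<and> c \<sim> d \<and> a \<noteq> b \<and> a \<noteq> d \<and> b \<noteq> d \<and>
      \<not> a \<sim> b \<and> \<not> a \<sim> d \<and> \<not> b \<sim> d"
  then obtain c a b d where claw: "c \<sim> a" "c \<sim> b" "c \<sim> d" "a \<noteq> b" "a \<noteq> d" "b \<noteq> d"
    "\<not> a \<sim> b" "\<not> a \<sim> d" "\<not> b \<sim> d" by blast
  have K: "{a} \<subseteq> pverts G" "{a} \<subseteq> component {a} a" "c \<notin> {a}" "a \<sim> c"
    using claw(1) wellformed'(2)[OF claw(1)] component_self[of a "{a}"] adj_irrefl[of a]
      adj_sym[OF claw(1)] by auto
  have d: "d \<in> pverts G" "d \<notin> {a}"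
    using claw(5) wellformed'(2)[OF claw(3)] by auto
  have nad: "\<not> y \<sim> d" if "y \<in> {a}" for y
    using claw(8) that by simp
  obtain S where S: "finite S" "minimal_separator G S" "c \<in> S"
    and SN: "\<And>s. s \<in> S \<Longrightarrow> s \<notin> {a} \<and> (\<exists>y \<in> {a}. y \<sim> s)" and dS: "d \<in> pverts G - S"
    and a: "{a} \<subseteq> component (pverts G - S) a"
    and neq: "component (pverts G - S) a \<noteq> component (pverts G - S) d"
    by (rule exists_separating_minimal_separator[OF assms _ K(1) _ K(2) d nad K(3) _ K(4) claw(3)])
      simp_all
  let ?X = "pverts G - S"
  have "b \<notin> S" using SN claw(7) by blast
  then have ab: "a \<in> ?X" "b \<in> ?X"
    using a component_subset wellformed'(2)[OF claw(2)] by blast+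
  note adj = separator_neighbours_adj[OF assms(3) S]
  \<comment> \<open>A third component, that of \<open>b\<close>, would exceed the two that the hypothesis allows.\<close>
  have "card {component ?X a, component ?X b, component ?X d} \<le> card (component ?X ` ?X)"
    using separator_levels(1)[OF assms(3) S] ab dS by (intro card_mono) (auto intro: card_ge_0_finite)
  then have "component ?X b = component ?X a \<or> component ?X b = component ?X d"
    using separator_levels(1)[OF assms(3) S] neq by (auto simp: card_insert_if split: if_splits)
  then show False
  proof
    assume "component ?X b = component ?X a"
    then have "a \<sim> b"
      using adj[OF ab(1), of a b] claw component_self[OF ab(1)] component_self[OF ab(2)] by simp
    then show False using claw by simp
  next
    assume "component ?X b = component ?X d"
    then have "b \<sim> d"
      using adj[OF ab(2), of b d] claw component_self[OF ab(2)] component_self[OF dS] by simp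
    then show False using claw by simp
  qed
qed

text \<open>
  Separate the pendant \<open>x'\<close> of a net from the path \<open>y' y z z'\<close> by a minimal \<open>S\<close> inside the
  neighbourhood of that path. Then \<open>x \<in> S\<close>, and the non-adjacent \<open>y', z'\<close> both have distance 2 from
  \<open>x\<close> through the component that contains the path.
\<close>
lemma separators_complete_net_free:
  assumes "Digraph_Component.connected G" "locally_finite G" "separators_distance_2_complete"
  shows "induced_free net G"
  unfolding net_free_iff
proof
  assume "\<exists>x y z x' y' z'. distinct [x, y, z, x', y', z'] \<and>
      x \<sim> y \<and> y \<sim> z \<and> x \<sim> z \<and> x \<sim> x' \<and> y \<sim> y' \<and> z \<sim> z' \<and>
      \<not> x \<sim> y' \<and> \<not> x \<sim> z' \<and> \<not> y \<sim> x' \<and> \<not> y \<sim> z' \<and> \<not> z \<sim> x' \<and> \<not> z \<sim> y' \<and>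
      \<not> x' \<sim> y' \<and> \<not> x' \<sim> z' \<and> \<not> y' \<sim> z'"
  then obtain x y z x' y' z' where dist: "distinct [x, y, z, x', y', z']"
    and adj: "x \<sim> y" "y \<sim> z" "x \<sim> z" "x \<sim> x'" "y \<sim> y'" "z \<sim> z'"
    and nadj: "\<not> x \<sim> y'" "\<not> x \<sim> z'" "\<not> y \<sim> x'" "\<not> z \<sim> x'"
      "\<not> x' \<sim> y'" "\<not> x' \<sim> z'" "\<not> y' \<sim> z'" by blast
  let ?K = "{y, z, y', z'}"
  have "y \<in> component ?K y" by (simp add: component_self)
  moreover from this have "z \<in> component ?K y" "y' \<in> component ?K y"
    using component_step[of y ?K y] adj(2,5) by auto
  moreover from this have "z' \<in> component ?K y"
    using component_step[of z ?K y z'] adj(6) by auto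
  ultimately have K: "?K \<subseteq> component ?K y" by simp
  have V: "x' \<in> pverts G" "?K \<subseteq> pverts G" using adj wellformed' by blast+
  have nK: "\<not> w \<sim> x'" if "w \<in> ?K" for w
    using that nadj not_adj_sym by auto
  obtain S where S: "finite S" "minimal_separator G S" "x \<in> S"
    and KC: "?K \<subseteq> component (pverts G - S) y"
    by (rule exists_separating_minimal_separator[OF assms _ V(2) _ K V(1) _ nK, of x y])
      (use dist adj adj_sym in auto)
  let ?L = "verts_at_dist (G \<restriction> insert x (component (pverts G - S) y)) x 2"
  have "y' \<in> ?L" by (rule level_2I[of _ _ y]) (use KC adj nadj dist in auto)
  moreover have "z' \<in> ?L" by (rule level_2I[of _ _ z]) (use KC adj nadj dist in auto)
  moreover have "y \<in> pverts G - S" using KC component_subset by blast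
  ultimately have "y' \<sim> z'"
    using separator_levels(2)[OF assms(3) S] dist by auto
  then show False using nadj by simp
qed

end

theorem theorem1p6:
  fixes G :: "'a pair_pre_digraph"
  assumes "pair_bidirected_digraph G"
    and "locally_finite G"
    and "Digraph_Component.connected G"
  shows "induced_free claw G \<and> induced_free net G \<longleftrightarrow>
    (\<forall>S. finite S \<and> minimal_separator G S \<longrightarrow>
      (\<forall>v \<in> S. distance_2_complete (delete_verts G (S - {v})) v))"
proof -
  interpret pair_bidirected_digraph G by fact
  have "induced_free claw G \<and> induced_free net G \<longleftrightarrow> separators_distance_2_complete"
    using claw_net_free_distance_2_complete separators_complete_claw_free[OF assms(3,2)]
      separators_complete_net_free[OF assms(3,2)]
    unfolding separators_distance_2_complete_def by blast
  then show ?thesis unfolding separators_distance_2_complete_def .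
qed

end
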